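(* Let $(G,q_1)$ and $(\Gamma,q_2)$ be metric groups such that $G_2=\{0,g_0\}\cong\mathbb{Z}_2$, $\Gamma_2=\{0,\gamma_0\}\cong\mathbb{Z}_2$, $c:=\mathcal{G}(q_1)=-\mathcal{G}(q_2)$, $\langle g_0,g_0\rangle=-\langle\gamma_0,\gamma_0\rangle$, $c^2=q_1(g_0)^{-1}q_2(\gamma_0)$, and $|\Gamma|=|G|+2$. With $J$, $N$, $\nu_m$ as in the context, for all $m\in\mathbb{N}$, $\varepsilon\in\{1,-1\}$, $g\in G_*$, $\gamma\in\Gamma_*$: $$\nu_m(\pi)=\tfrac12|\mathcal{G}(q_1,m)+\mathcal{G}(q_2,m)|^2,$$ $$\nu_m((g_0,\varepsilon))=\tfrac14|\mathcal{G}(q_1,m)+\mathcal{G}(q_2,m)|^2+\tfrac12\delta_{mg_0,0}\,q_1(g_0)^m,$$ $$\nu_m(g)=\tfrac12|\mathcal{G}(q_1,m)+\mathcal{G}(q_2,m)|^2+\delta_{mg,0}\,q_1(g)^m,$$ $$\nu_m((\gamma_0,\varepsilon))=\tfrac14|\mathcal{G}(q_1,m)+\mathcal{G}(q_2,m)|^2-\tfrac12\delta_{m\gamma_0,0}\,q_2(\gamma_0)^m,$$ $$\nu_m(\gamma)=\tfrac12|\mathcal{G}(q_1,m)+\mathcal{G}(q_2,m)|^2-\delta_{m\gamma,0}\,q_2(\gamma)^m.$$ In particular: (a) the condition (FS2), that for every $k\in J$ one has $\nu_2(k)=0$ if $k\ne\overline k$ and $\nu_2(k)\in\{1,-1\}$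 if $k=\overline k$, is equivalent to $|\mathcal{G}(q_1,2)+\mathcal{G}(q_2,2)|=\sqrt2$; (b) the condition (FS3), that for every $k\in J$ the number $\nu_3(k)$ is a sum of $N_{k,k,k}$ numbers belonging to $\{1,e^{2\pi i/3},e^{4\pi i/3}\}$, is equivalent to $|\mathcal{G}(q_1,3)+\mathcal{G}(q_2,3)|=2$.
   Context: A metric group $(G,q)$ is a finite abelian group $G$ with a map $q:G\to\mathbb{T}=\{z\in\mathbb{C}:|z|=1\}$ such that $q(-g)=q(g)$ and $\langle g,h\rangle=q(g+h)q(g)^{-1}q(h)^{-1}$ is a non-degenerate bicharacter. $\mathcal{G}(q,m)=\frac{1}{\sqrt{|G|}}\sum_{g\in G}q(g)^m$, $\mathcal{G}(q)=\mathcal{G}(q,1)$. $G_2=\{g\in G:2g=0\}$. Put $s=c\,\frac{q_1(g_0)^{-1}+q_2(\gamma_0)^{-1}}{\sqrt2}$, $a=1/\sqrt{|G|}$, $b=1/\sqrt{|\Gamma|}$. Fix $G_*\subset G$, $\Gamma_*\subset\Gamma$ with $G=G_2\sqcup G_*\sqcup(-G_* )$, $\Gamma=\Gamma_2\sqcup\Gamma_*\sqcup(-\Gamma_* )$. Let $J_1=\{g_0\}\times\{1,-1\}$, $J_2=\{\gamma_0\}\times\{1,-1\}$, $J=\{0,\pi\}\sqcup J_1\sqcup G_*\sqcup J_2\sqcup\Gamma_*$. Involution on $J$: $\overline{(g_0,\varepsilon)}=(g_0,\langle g_0,g_0\rangle\varepsilon)$, $\overline{(\gamma_0,\varepsilon)}=(\gamma_0,\langle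 g_0,g_0\rangle\varepsilon)$, all other indices fixed. With blocks indexed in order by $\{0\},\{\pi\},J_1,G_*,J_2,\Gamma_*$ (rows $0,\pi,(g_0,\varepsilon),g,(\gamma_0,\varepsilon),\gamma$; columns with primes): $$S=\begin{pmatrix} \frac{a-b}{2}&\frac{a+b}{2}&\frac{a}{2}&a&\frac{b}{2}&b\\ \frac{a+b}{2}&\frac{a-b}{2}&\frac{a}{2}&a&-\frac{b}{2}&-b\\ \frac{a}{2}&\frac{a}{2}&(\frac{a}{2}+\frac{\varepsilon\varepsilon's}{2\sqrt{2}})\langle g_0,g_0\rangle&a\langle g_0,g'\rangle&\frac{\varepsilon\varepsilon's}{2\sqrt{2}}&0\\ a&a&a\langle g,g_0\rangle&a(\langle g,g'\rangle+\overline{\langle g,g'\rangle})&0&0\\ \frac{b}{2}&-\frac{b}{2}&\frac{\varepsilon\varepsilon's}{2\sqrt{2}}&0&-(\frac{b}{2}-\frac{\varepsilon\varepsilon's}{2\sqrt{2}})\langle\gamma_0,\gamma_0\rangle&-b\langle\gamma_0,\gamma'\rangle\\ b&-b&0&0&-b\langle\gamma,\gamma_0\rangle&-b(\langle\gamma,\gamma'\rangle+\overline{\langle\gamma,\gamma'\rangle}) \end{pmatrix},$$ $T=\mathrm{Diag}(1,1,q_1(g_0),q_1(g),q_2(\gamma_0),q_2(\gamma))$. Further $N_{i,j,k}=\sum_{w\in J}S_{w,i}S_{w,j}S_{w,k}/S_{0,w}$, $N_{i,j}^k=N_{i,j,\overline k}$, and $\nu_m(k)=\sum_{i,j\in J}N_{i,j}^k\,S_{0,i}S_{0,j}(T_{j,j}/T_{i,i})^m$.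 *)

theory Defs
  imports Complex_Main "HOL-Library.Cardinality"
begin

text \<open>A finite abelian group is a type of class \<^class>\<open>finite\<close> and \<^class>\<open>ab_group_add\<close>; the circle
  is the set of complex numbers of norm 1.\<close>

definition bichar :: "('g::ab_group_add \<Rightarrow> complex) \<Rightarrow> 'g \<Rightarrow> 'g \<Rightarrow> complex" where
  "bichar q g h = q (g + h) * inverse (q g) * inverse (q h)"

definition is_bicharacter :: "('g::ab_group_add \<Rightarrow> 'g \<Rightarrow> complex) \<Rightarrow> bool" where
  "is_bicharacter B \<longleftrightarrow>
     (\<forall>g h. norm (B g h) = 1) \<and>
     (\<forall>g g' h. B (g + g') h = B g h * B g' h) \<and>
     (\<forall>g h h'. B g (h + h') = B g h * B g h')"

definition nondegenerate :: "('g::ab_group_add \<Rightarrow> 'g \<Rightarrow> complex) \<Rightarrow> bool" where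
  "nondegenerate B \<longleftrightarrow>
     (\<forall>g. (\<forall>h. B g h = 1) \<longrightarrow> g = 0) \<and> (\<forall>h. (\<forall>g. B g h = 1) \<longrightarrow> h = 0)"

definition metric_group :: "('g::{finite,ab_group_add} \<Rightarrow> complex) \<Rightarrow> bool" where
  "metric_group q \<longleftrightarrow>
     (\<forall>g. norm (q g) = 1) \<and> (\<forall>g. q (- g) = q g) \<and>
     is_bicharacter (bichar q) \<and> nondegenerate (bichar q)"

definition gauss_sum :: "('g::{finite,ab_group_add} \<Rightarrow> complex) \<Rightarrow> nat \<Rightarrow> complex" where
  "gauss_sum q m = complex_of_real (1 / sqrt (real CARD('g))) * (\<Sum>g\<in>UNIV. q g ^ m)"

definition two_torsion :: "'g::ab_group_add set" where
  "two_torsion = {g. g + g = 0}"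

definition nat_mult :: "nat \<Rightarrow> 'g::ab_group_add \<Rightarrow> 'g" where
  "nat_mult m g = (\<Sum>i<m. g)"

definition half_system :: "'g::ab_group_add set \<Rightarrow> bool" where
  "half_system A \<longleftrightarrow>
     UNIV = two_torsion \<union> A \<union> uminus ` A \<and>
     two_torsion \<inter> A = {} \<and> two_torsion \<inter> uminus ` A = {} \<and> A \<inter> uminus ` A = {}"

text \<open>\<open>I_zero\<close> and \<open>I_pi\<close> are the indices \<open>0\<close> and \<open>\<pi>\<close>. The sign \<open>\<epsilon>\<close> of an index in \<open>J\<^sub>1\<close> or \<open>J\<^sub>2\<close> is
  stored as a complex number, since the involution multiplies it by the complex number
  \<open>\<langle>g\<^sub>0, g\<^sub>0\<rangle>\<close>. The values of \<open>conj_idx\<close>, \<open>S_mat\<close> and \<open>T_mat\<close> are used only on the set \<open>J\<close>.\<close>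

datatype ('g, 'h) idx =
    I_zero
  | I_pi
  | I_J1 'g complex
  | I_G 'g
  | I_J2 'h complex
  | I_Gamma 'h

definition J_set :: "'g \<Rightarrow> 'h \<Rightarrow> 'g set \<Rightarrow> 'h set \<Rightarrow> ('g, 'h) idx set" where
  "J_set g0 \<gamma>0 Gs \<Gamma>s =
     {I_zero, I_pi} \<union> I_J1 g0 ` {1, -1} \<union> I_G ` Gs \<union> I_J2 \<gamma>0 ` {1, -1} \<union> I_Gamma ` \<Gamma>s"

fun conj_idx :: "('g::ab_group_add \<Rightarrow> complex) \<Rightarrow> 'g \<Rightarrow> ('g, 'h) idx \<Rightarrow> ('g, 'h) idx" where
  "conj_idx q1 g0 (I_J1 g \<epsilon>) = I_J1 g (bichar q1 g0 g0 * \<epsilon>)"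
| "conj_idx q1 g0 (I_J2 \<gamma> \<epsilon>) = I_J2 \<gamma> (bichar q1 g0 g0 * \<epsilon>)"
| "conj_idx q1 g0 I_zero = I_zero"
| "conj_idx q1 g0 I_pi = I_pi"
| "conj_idx q1 g0 (I_G g) = I_G g"
| "conj_idx q1 g0 (I_Gamma \<gamma>) = I_Gamma \<gamma>"

definition s_const ::
  "('g::{finite,ab_group_add} \<Rightarrow> complex) \<Rightarrow> ('h::{finite,ab_group_add} \<Rightarrow> complex) \<Rightarrow> 'g \<Rightarrow> 'h \<Rightarrow> complex"
where
  "s_const q1 q2 g0 \<gamma>0 =
     gauss_sum q1 1 * ((inverse (q1 g0) + inverse (q2 \<gamma>0)) / complex_of_real (sqrt 2))"

definition S_mat ::
  "('g::{finite,ab_group_add} \<Rightarrow> complex) \<Rightarrow> ('h::{finite,ab_group_add} \<Rightarrow> complex) \<Rightarrow> 'g \<Rightarrow> 'h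
    \<Rightarrow> ('g, 'h) idx \<Rightarrow> ('g, 'h) idx \<Rightarrow> complex"
where
  "S_mat q1 q2 g0 \<gamma>0 x y =
     (let a = complex_of_real (1 / sqrt (real CARD('g)));
          b = complex_of_real (1 / sqrt (real CARD('h)));
          s = s_const q1 q2 g0 \<gamma>0;
          r = complex_of_real (2 * sqrt 2);
          B1 = bichar q1;
          B2 = bichar q2
      in case x of
        I_zero \<Rightarrow> (case y of
            I_zero \<Rightarrow> (a - b) / 2
          | I_pi \<Rightarrow> (a + b) / 2
          | I_J1 _ _ \<Rightarrow> a / 2
          | I_G _ \<Rightarrow> a
          | I_J2 _ _ \<Rightarrow> b / 2
          | I_Gamma _ \<Rightarrow> b)
      | I_pi \<Rightarrow> (case y of
            I_zero \<Rightarrow> (a + b) / 2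
          | I_pi \<Rightarrow> (a - b) / 2
          | I_J1 _ _ \<Rightarrow> a / 2
          | I_G _ \<Rightarrow> a
          | I_J2 _ _ \<Rightarrow> - (b / 2)
          | I_Gamma _ \<Rightarrow> - b)
      | I_J1 _ \<epsilon> \<Rightarrow> (case y of
            I_zero \<Rightarrow> a / 2
          | I_pi \<Rightarrow> a / 2
          | I_J1 _ \<epsilon>' \<Rightarrow> (a / 2 + \<epsilon> * \<epsilon>' * s / r) * B1 g0 g0
          | I_G g' \<Rightarrow> a * B1 g0 g'
          | I_J2 _ \<epsilon>' \<Rightarrow> \<epsilon> * \<epsilon>' * s / r
          | I_Gamma _ \<Rightarrow> 0)
      | I_G g \<Rightarrow> (case y of
            I_zero \<Rightarrow> a
          | I_pi \<Rightarrow> a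
          | I_J1 _ _ \<Rightarrow> a * B1 g g0
          | I_G g' \<Rightarrow> a * (B1 g g' + cnj (B1 g g'))
          | I_J2 _ _ \<Rightarrow> 0
          | I_Gamma _ \<Rightarrow> 0)
      | I_J2 _ \<epsilon> \<Rightarrow> (case y of
            I_zero \<Rightarrow> b / 2
          | I_pi \<Rightarrow> - (b / 2)
          | I_J1 _ \<epsilon>' \<Rightarrow> \<epsilon> * \<epsilon>' * s / r
          | I_G _ \<Rightarrow> 0
          | I_J2 _ \<epsilon>' \<Rightarrow> - (b / 2 - \<epsilon> * \<epsilon>' * s / r) * B2 \<gamma>0 \<gamma>0
          | I_Gamma \<gamma>' \<Rightarrow> - b * B2 \<gamma>0 \<gamma>')
      | I_Gamma \<gamma> \<Rightarrow> (case y of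
            I_zero \<Rightarrow> b
          | I_pi \<Rightarrow> - b
          | I_J1 _ _ \<Rightarrow> 0
          | I_G _ \<Rightarrow> 0
          | I_J2 _ _ \<Rightarrow> - b * B2 \<gamma> \<gamma>0
          | I_Gamma \<gamma>' \<Rightarrow> - b * (B2 \<gamma> \<gamma>' + cnj (B2 \<gamma> \<gamma>'))))"

fun T_diag ::
  "('g \<Rightarrow> complex) \<Rightarrow> ('h \<Rightarrow> complex) \<Rightarrow> 'g \<Rightarrow> 'h \<Rightarrow> ('g, 'h) idx \<Rightarrow> complex"
where
  "T_diag q1 q2 g0 \<gamma>0 I_zero = 1"
| "T_diag q1 q2 g0 \<gamma>0 I_pi = 1"
| "T_diag q1 q2 g0 \<gamma>0 (I_J1 _ _) = q1 g0"
| "T_diag q1 q2 g0 \<gamma>0 (I_G g) = q1 g"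
| "T_diag q1 q2 g0 \<gamma>0 (I_J2 _ _) = q2 \<gamma>0"
| "T_diag q1 q2 g0 \<gamma>0 (I_Gamma \<gamma>) = q2 \<gamma>"

definition T_mat ::
  "('g \<Rightarrow> complex) \<Rightarrow> ('h \<Rightarrow> complex) \<Rightarrow> 'g \<Rightarrow> 'h \<Rightarrow> ('g, 'h) idx \<Rightarrow> ('g, 'h) idx \<Rightarrow> complex"
where
  "T_mat q1 q2 g0 \<gamma>0 x y = (if x = y then T_diag q1 q2 g0 \<gamma>0 x else 0)"

definition N_coeff ::
  "('g::{finite,ab_group_add} \<Rightarrow> complex) \<Rightarrow> ('h::{finite,ab_group_add} \<Rightarrow> complex) \<Rightarrow> 'g \<Rightarrow> 'h
    \<Rightarrow> 'g set \<Rightarrow> 'h set \<Rightarrow> ('g, 'h) idx \<Rightarrow> ('g, 'h) idx \<Rightarrow> ('g, 'h) idx \<Rightarrow> complex"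
where
  "N_coeff q1 q2 g0 \<gamma>0 Gs \<Gamma>s i j k =
     (let S = S_mat q1 q2 g0 \<gamma>0
      in \<Sum>w\<in>J_set g0 \<gamma>0 Gs \<Gamma>s. S w i * S w j * S w k / S I_zero w)"

definition FS_indicator ::
  "('g::{finite,ab_group_add} \<Rightarrow> complex) \<Rightarrow> ('h::{finite,ab_group_add} \<Rightarrow> complex) \<Rightarrow> 'g \<Rightarrow> 'h
    \<Rightarrow> 'g set \<Rightarrow> 'h set \<Rightarrow> nat \<Rightarrow> ('g, 'h) idx \<Rightarrow> complex"
where
  "FS_indicator q1 q2 g0 \<gamma>0 Gs \<Gamma>s m k =
     (let S = S_mat q1 q2 g0 \<gamma>0; T = T_mat q1 q2 g0 \<gamma>0; J = J_set g0 \<gamma>0 Gs \<Gamma>s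
      in \<Sum>i\<in>J. \<Sum>j\<in>J. N_coeff q1 q2 g0 \<gamma>0 Gs \<Gamma>s i j (conj_idx q1 g0 k)
                          * S I_zero i * S I_zero j * (T j j / T i i) ^ m)"

definition FS2 ::
  "('g::{finite,ab_group_add} \<Rightarrow> complex) \<Rightarrow> ('h::{finite,ab_group_add} \<Rightarrow> complex) \<Rightarrow> 'g \<Rightarrow> 'h
    \<Rightarrow> 'g set \<Rightarrow> 'h set \<Rightarrow> bool"
where
  "FS2 q1 q2 g0 \<gamma>0 Gs \<Gamma>s \<longleftrightarrow>
     (\<forall>k\<in>J_set g0 \<gamma>0 Gs \<Gamma>s.
        (k \<noteq> conj_idx q1 g0 k \<longrightarrow> FS_indicator q1 q2 g0 \<gamma>0 Gs \<Gamma>s 2 k = 0) \<and>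
        (k = conj_idx q1 g0 k \<longrightarrow> FS_indicator q1 q2 g0 \<gamma>0 Gs \<Gamma>s 2 k \<in> {1, -1}))"

text \<open>The list \<open>zs\<close> holds the summands, so \<open>FS3\<close> also requires each \<open>N\<^sub>k\<^sub>,\<^sub>k\<^sub>,\<^sub>k\<close> to be a natural number.\<close>

definition FS3 ::
  "('g::{finite,ab_group_add} \<Rightarrow> complex) \<Rightarrow> ('h::{finite,ab_group_add} \<Rightarrow> complex) \<Rightarrow> 'g \<Rightarrow> 'h
    \<Rightarrow> 'g set \<Rightarrow> 'h set \<Rightarrow> bool"
where
  "FS3 q1 q2 g0 \<gamma>0 Gs \<Gamma>s \<longleftrightarrow>
     (\<forall>k\<in>J_set g0 \<gamma>0 Gs \<Gamma>s. \<exists>zs :: complex list.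
        of_nat (length zs) = N_coeff q1 q2 g0 \<gamma>0 Gs \<Gamma>s k k k \<and>
        set zs \<subseteq> {1, exp (2 * of_real pi * \<i> / 3), exp (4 * of_real pi * \<i> / 3)} \<and>
        FS_indicator q1 q2 g0 \<gamma>0 Gs \<Gamma>s 3 k = sum_list zs)"

end

theory Submission
  imports Defs
begin

text \<open>
  Summing over \<open>i\<close> and \<open>j\<close> first gives \<open>\<nu>\<^sub>m(k) = \<Sum>\<^sub>w S\<^bsub>w,k'\<^esub> / S\<^bsub>0,w\<^esub> \<bar>Y\<^sub>w\<bar>\<^sup>2\<close>, where \<open>k'\<close> is the
  conjugate of \<open>k\<close> and \<open>Y\<^sub>w = \<Sum>\<^sub>j S\<^bsub>w,j\<^esub> S\<^bsub>0,j\<^esub> T\<^sub>j\<^sup>m\<close>. The half systems fold sums of even functions over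
  the two groups, so \<open>Y\<close> is, up to factors \<open>a\<close> and \<open>b\<close>, the pair of Fourier transforms \<open>F\<close>, \<open>H\<close> of
  \<open>q\<^sub>1\<^sup>m\<close>, \<open>q\<^sub>2\<^sup>m\<close>; at \<open>0\<close> and \<open>\<pi>\<close> it mixes the Gauss sums \<open>F(0)\<close> and \<open>H(0)\<close>. By orthogonality of
  characters \<open>\<Sum>\<^sub>h \<langle>h,g\<rangle> \<bar>F(h)\<bar>\<^sup>2\<close> is \<open>\<bar>G\<bar> q\<^sub>1(g)\<^sup>m\<close> if \<open>m g = 0\<close> and vanishes otherwise; the rest is
  algebra with \<open>a\<^sup>2 - b\<^sup>2 = 2 a\<^sup>2 b\<^sup>2\<close>, that is \<open>\<bar>\<Gamma>\<bar> = \<bar>G\<bar> + 2\<close>. The signs \<open>\<epsilon>\<close> cancel in pairs, except in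
  \<open>N\<^sub>k\<^sub>k\<^sub>k\<close> for \<open>k \<in> J\<^sub>1 \<union> J\<^sub>2\<close>, where \<open>s\<^sup>2 = \<langle>g\<^sub>0,g\<^sub>0\<rangle>\<close> enters. For (b), \<open>\<nu>\<^sub>3(\<pi>)\<close> is real, nonnegative and a
  sum of \<open>N\<^sub>\<pi>\<^sub>\<pi>\<^sub>\<pi> = 2\<close> cube roots of unity, hence \<open>2\<close>; conversely, if \<open>\<nu>\<^sub>3(\<pi>) = 2\<close> then
  \<open>\<nu>\<^sub>3(k) = N\<^sub>k\<^sub>k\<^sub>k\<close> for all \<open>k\<close>.
\<close>

section \<open>Fourier transforms and sums of even functions over a half system\<close>

definition fourier :: "('g::{finite,ab_group_add} \<Rightarrow> complex) \<Rightarrow> ('g \<Rightarrow> complex) \<Rightarrow> 'g \<Rightarrow> complex" where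
  "fourier q f h = complex_of_real (1 / sqrt (real CARD('g))) * (\<Sum>g\<in>UNIV. bichar q h g * f g)"

lemma sum_even_half_system:
  fixes f :: "'g::{finite,ab_group_add} \<Rightarrow> complex"
  assumes "half_system A" "two_torsion = {0, g0}" "g0 \<noteq> 0" and even: "\<And>g. f (- g) = f g"
  shows "(\<Sum>g\<in>UNIV. f g) = f 0 + f g0 + 2 * (\<Sum>g\<in>A. f g)"
proof -
  have U: "UNIV = {0, g0} \<union> (A \<union> uminus ` A)" and d: "{0, g0} \<inter> (A \<union> uminus ` A) = {}"
    and d': "A \<inter> uminus ` A = {}"
    using assms unfolding half_system_def by auto
  have "(\<Sum>g\<in>uminus ` A. f g) = (\<Sum>g\<in>A. f g)"
    by (subst sum.reindex) (auto simp: even)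
  moreover have "(\<Sum>g\<in>UNIV. f g) = (\<Sum>g\<in>{0, g0}. f g) + ((\<Sum>g\<in>A. f g) + (\<Sum>g\<in>uminus ` A. f g))"
    using U d d' by (metis finite sum.union_disjoint)
  ultimately show ?thesis
    using assms(3) by simp
qed

section \<open>Characters, orthogonality and power spectra on one metric group\<close>

locale metric_group_form =
  fixes q :: "'g::{finite,ab_group_add} \<Rightarrow> complex"
  assumes metric_group: "metric_group q"
begin

abbreviation B where "B \<equiv> bichar q"

lemma norm_q [simp]: "norm (q g) = 1" and q_minus [simp]: "q (- g) = q g"
  and norm_B [simp]: "norm (B g h) = 1"
  and B_add_left: "B (g + g') h = B g h * B g' h"
  and B_add_right: "B g (h + h') = B g h * B g h'"
  using metric_group unfolding metric_group_def is_bicharacter_def by blast+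

lemma B_nondegenerate: "(\<And>g. B g h = 1) \<Longrightarrow> h = 0"
  using metric_group unfolding metric_group_def nondegenerate_def by blast

lemma q_nonzero [simp]: "q g \<noteq> 0" and B_nonzero [simp]: "B g h \<noteq> 0"
proof -
  have "norm (q g) \<noteq> 0" "norm (B g h) \<noteq> 0"
    by simp_all
  then show "q g \<noteq> 0" "B g h \<noteq> 0"
    unfolding norm_eq_zero .
qed

lemma cnj_q: "cnj (q g) = inverse (q g)" and cnj_B: "cnj (B g h) = inverse (B g h)"
  by (simp_all add: divide_conv_cnj inverse_eq_divide)

lemma B_zero_left [simp]: "B 0 h = 1" and B_zero_right [simp]: "B h 0 = 1"
  using B_add_left[of 0 0 h] B_add_right[of h 0 0] by auto

lemma q_zero [simp]: "q 0 = 1"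
  using B_zero_left[of 0] unfolding bichar_def by simp

lemma B_commute: "B g h = B h g"
  by (simp add: bichar_def add.commute mult.commute mult.left_commute)

lemma B_minus_left: "B (- g) h = inverse (B g h)" and B_minus_right: "B h (- g) = inverse (B h g)"
proof -
  have "B g h * B (- g) h = 1" "B h g * B h (- g) = 1"
    by (simp_all flip: B_add_left B_add_right)
  then show "B (- g) h = inverse (B g h)" "B h (- g) = inverse (B h g)"
    by (metis inverse_unique)+
qed

text \<open>Since \<open>q\<close> is even and \<open>q 0 = 1\<close>, unfolding
  \<open>B g (- g)\<close> gives the inverse square of \<open>q g\<close>, while multiplicativity
  gives the inverse of \<open>B g g\<close>.\<close>

lemma B_self: "B g g = (q g)\<^sup>2"
proof -
  have "inverse (B g g) = inverse (q g) * inverse (q g)"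
    using B_minus_right[of g g] by (simp add: bichar_def)
  then show ?thesis
    by (metis inverse_inverse_eq inverse_mult_distrib power2_eq_square)
qed

lemma q_add: "q (g + h) = q g * q h * B g h"
  by (simp add: bichar_def field_simps)

lemma B_nat_mult: "B h (nat_mult m g) = B h g ^ m"
  by (induction m) (simp_all add: nat_mult_def B_add_right mult.commute)

lemma nat_mult_eq_0_iff: "nat_mult m g = 0 \<longleftrightarrow> (\<forall>h. B h g ^ m = 1)"
  by (metis B_nat_mult B_nondegenerate B_zero_right)

text \<open>Orthogonality: translating the summation variable by some \<open>k\<close> with
  \<open>B k g \<noteq> 1\<close> multiplies the sum by \<open>B k g\<close>, so it
  vanishes.\<close>

lemma sum_B: "(\<Sum>h\<in>UNIV. B h g) = of_bool (g = 0) * of_nat CARD('g)"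
proof (cases "g = 0")
  case False
  then obtain k where k: "B k g \<noteq> 1"
    using B_nondegenerate by blast
  have "(\<Sum>h\<in>UNIV. B h g) = (\<Sum>h\<in>UNIV. B (h + k) g)"
    by (rule sum.reindex_bij_witness[of _ "\<lambda>h. h + k" "\<lambda>h. h - k"]) auto
  also have "\<dots> = (\<Sum>h\<in>UNIV. B h g) * B k g"
    by (simp add: B_add_left sum_distrib_right)
  finally show ?thesis
    using k False by simp
qed simp

lemma sum_B_power: "(\<Sum>h\<in>UNIV. B h g ^ m) = of_bool (nat_mult m g = 0) * of_nat CARD('g)"
  using sum_B[of "nat_mult m g"] by (simp add: B_nat_mult)

text \<open>The square of \<open>q g ^ m\<close> is \<open>B g g ^ m\<close>, the value of a
  character at \<open>m g = 0\<close>; so \<open>q g ^ m\<close> is a sign.\<close>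

lemma q_power_inverse:
  assumes "nat_mult m g = 0"
  shows "inverse (q g ^ m) = q g ^ m"
proof -
  have "(q g ^ m) * (q g ^ m) = B g g ^ m"
    by (simp add: B_self power2_eq_square power_mult_distrib)
  also have "\<dots> = 1"
    using assms nat_mult_eq_0_iff by blast
  finally show ?thesis
    by (simp add: inverse_unique)
qed

text \<open>Evaluating \<open>q\<close> at \<open>3 g = 0\<close> gives \<open>q g ^ 9 = 1\<close>,
  and \<open>q_power_inverse\<close> gives \<open>q g ^ 6 = 1\<close>. Hence the delta terms of the
  third indicators are integers.\<close>

lemma q_cube:
  assumes "nat_mult 3 g = 0"
  shows "q g ^ 3 = 1"
proof -
  have g3: "g + g + g = 0"
    using assms by (simp add: nat_mult_def numeral_3_eq_3 lessThan_Suc add.assoc)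
  have "q (g + g + g) = q g ^ 9"
    by (simp only: q_add B_add_left B_self) (simp add: eval_nat_numeral)
  then have "q g ^ 9 = 1"
    by (simp add: g3)
  moreover have "q g ^ 3 * q g ^ 3 = 1"
    using q_power_inverse[OF assms] right_inverse[of "q g ^ 3"] by simp
  moreover have "q g ^ 9 = (q g ^ 3 * q g ^ 3) * q g ^ 3"
    by (simp only: power_add[symmetric]) simp
  ultimately show ?thesis
    by (metis mult_1)
qed

lemma fourier_zero: "fourier q (\<lambda>g. q g ^ m) 0 = gauss_sum q m"
  by (simp add: fourier_def gauss_sum_def)

lemma fourier_minus:
  assumes "\<And>g. f (- g) = f g"
  shows "fourier q f (- h) = fourier q f h"
proof -
  have "(\<Sum>g\<in>UNIV. B (- h) g * f g) = (\<Sum>g\<in>UNIV. B h g * f g)"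
    by (rule sum.reindex_bij_witness[of _ uminus uminus])
      (auto simp: assms B_minus_left B_minus_right)
  then show ?thesis
    by (simp add: fourier_def)
qed

text \<open>Conjugation inverts both the character and \<open>q\<close>; reflecting the summation
  variable restores the character.\<close>

lemma fourier_inverse_q:
  "fourier q (\<lambda>g. inverse (q g) ^ m) h = cnj (fourier q (\<lambda>g. q g ^ m) h)"
proof -
  have "(\<Sum>g\<in>UNIV. B h g * inverse (q g) ^ m) = (\<Sum>g\<in>UNIV. inverse (B h g) * inverse (q g) ^ m)"
    by (rule sum.reindex_bij_witness[of _ uminus uminus])
      (auto simp: B_minus_right)
  then show ?thesis
    by (simp add: fourier_def cnj_q cnj_B)
qed

text \<open>Expanding the product gives a double sum over \<open>x\<close> and \<open>y\<close>.
  Summing over \<open>h\<close> forces \<open>y = - (g + x)\<close>; the remaining sum over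
  \<open>x\<close> is that of the \<open>m\<close>-th power of a character, which vanishes unless
  \<open>m g = 0\<close>, and then \<open>q_power_inverse\<close> removes the inverse.\<close>

lemma sum_B_fourier:
  fixes m :: nat
  defines "F \<equiv> fourier q (\<lambda>g. q g ^ m)"
  shows "(\<Sum>h\<in>UNIV. B h g * (F h * cnj (F h))) = of_nat CARD('g) * of_bool (nat_mult m g = 0) * q g ^ m"
proof -
  let ?a = "complex_of_real (1 / sqrt (real CARD('g)))"
  have a2: "?a * ?a * of_nat CARD('g) = 1"
    by (simp add: field_simps flip: of_real_mult)
  have "(\<Sum>h\<in>UNIV. B h g * (F h * cnj (F h)))
      = (\<Sum>h\<in>UNIV. ?a * ?a * (\<Sum>x\<in>UNIV. \<Sum>y\<in>UNIV. q x ^ m * inverse (q y) ^ m * B h (g + x + y)))"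
  proof (rule sum.cong[OF refl])
    fix h
    have "B h g * (F h * cnj (F h)) =
        B h g * (fourier q (\<lambda>g. q g ^ m) h * fourier q (\<lambda>g. inverse (q g) ^ m) h)"
      by (simp only: F_def fourier_inverse_q)
    also have "\<dots> = ?a * ?a * (B h g * ((\<Sum>x\<in>UNIV. B h x * q x ^ m) * (\<Sum>y\<in>UNIV. B h y * inverse (q y) ^ m)))"
      by (simp add: fourier_def)
    also have "B h g * ((\<Sum>x\<in>UNIV. B h x * q x ^ m) * (\<Sum>y\<in>UNIV. B h y * inverse (q y) ^ m)) =
       (\<Sum>x\<in>UNIV. \<Sum>y\<in>UNIV. q x ^ m * inverse (q y) ^ m * B h (g + x + y))"
      by (simp only: sum_product) (simp add: sum_distrib_left B_add_right ac_simps)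
    finally show "B h g * (F h * cnj (F h)) = 
      ?a * ?a * (\<Sum>x\<in>UNIV. \<Sum>y\<in>UNIV. q x ^ m * inverse (q y) ^ m * B h (g + x + y))" .
  qed
  also have "\<dots> = ?a * ?a * (\<Sum>x\<in>UNIV. \<Sum>y\<in>UNIV. \<Sum>h\<in>UNIV. q x ^ m * inverse (q y) ^ m * B h (g + x + y))"
    unfolding sum_distrib_left[symmetric, of "?a * ?a"]
    by (subst sum.swap) (intro arg_cong2[where f = "(*)"] refl sum.cong sum.swap)
  also have "\<dots> = ?a * ?a * (\<Sum>x\<in>UNIV. \<Sum>y\<in>UNIV.
      if y = - (g + x) then q x ^ m * inverse (q y) ^ m * of_nat CARD('g) else 0)"
    by (intro arg_cong2[where f = "(*)"] refl sum.cong)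
      (auto simp: sum_B add_eq_0_iff simp flip: sum_distrib_left)
  also have "\<dots> = (\<Sum>x\<in>UNIV. q x ^ m * inverse (q (g + x)) ^ m)"
    using a2 by (simp del: minus_add_distrib add: sum_distrib_left algebra_simps)
  also have "\<dots> = (\<Sum>x\<in>UNIV. inverse (q g) ^ m * B x (- g) ^ m)"
    by (intro sum.cong refl) (simp add: q_add B_minus_right B_commute[of g] field_simps)
  also have "\<dots> = inverse (q g) ^ m * (of_bool (nat_mult m g = 0) * of_nat CARD('g))"
    using sum_B_power[of "- g" m] nat_mult_eq_0_iff[of m g] nat_mult_eq_0_iff[of m "- g"]
    by (simp add: B_minus_right flip: sum_distrib_left) (simp add: power_inverse)
  also have "\<dots> = of_nat CARD('g) * of_bool (nat_mult m g = 0) * q g ^ m"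
    using q_power_inverse[of m g] by (auto simp: power_inverse)
  finally show ?thesis .
qed

end

section \<open>Sums over a half system when the two-torsion has order two\<close>

locale metric_group_halved = metric_group_form q
  for q :: "'g::{finite,ab_group_add} \<Rightarrow> complex" +
  fixes g0 :: 'g and A :: "'g set"
  assumes two_torsion: "two_torsion = {0, g0}" and g0_nonzero [simp]: "g0 \<noteq> 0"
    and half_system: "half_system A"
begin

lemma g0_add_g0: "g0 + g0 = 0"
  using two_torsion by (auto simp: two_torsion_def)

lemma B_g0_square: "B g0 h * B g0 h = 1"
  by (metis B_add_left B_zero_left g0_add_g0)

lemma cnj_B_g0 [simp]: "cnj (B g0 h) = B g0 h" "cnj (B h g0) = B h g0"
  using B_g0_square[of h] by (simp_all add: cnj_B B_commute[of h] inverse_unique)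

lemma sum_A:
  assumes "\<And>g. f (- g) = f g"
  shows "(\<Sum>g\<in>A. f g) = ((\<Sum>g\<in>UNIV. f g) - f 0 - f g0) / (2::complex)"
  using sum_even_half_system[OF half_system two_torsion g0_nonzero, of f] assms by simp

text \<open>The symmetrised character collects \<open>h\<close> and \<open>- h\<close> at once, so
  the sum over \<open>A\<close> misses only the fixed points \<open>0\<close> and \<open>g0\<close>
  of negation.\<close>

lemma sum_A_B:
  assumes even: "\<And>h. f (- h) = f h"
  shows "(\<Sum>h\<in>A. (B h g + cnj (B h g)) * f h) = (\<Sum>h\<in>UNIV. B h g * f h) - f 0 - B g0 g * f g0"
proof -
  have "(\<Sum>h\<in>UNIV. cnj (B h g) * f h) = (\<Sum>h\<in>UNIV. B h g * f h)"
    by (rule sum.reindex_bij_witness[of _ uminus uminus]) (auto simp: even B_minus_left cnj_B)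
  then show ?thesis
    by (subst sum_A) (simp_all add: even B_minus_left cnj_B[of _ g] cnj_B_g0(1)[unfolded cnj_B]
        add.commute distrib_right sum.distrib)
qed

text \<open>The shape in which a row of \<open>S\<close> produces the transform: one term each for
  \<open>0\<close> and \<open>g0\<close>, and symmetrised characters on \<open>A\<close>.\<close>

lemma fourier_half_system:
  assumes "\<And>h. f (- h) = f h"
  shows "fourier q f g = complex_of_real (1 / sqrt (real CARD('g)))
    * (f 0 + B g g0 * f g0 + (\<Sum>h\<in>A. (B g h + cnj (B g h)) * f h))"
  using sum_A_B[of f g] assms by (simp add: fourier_def B_commute[of g])

lemma sum_A_power_spectrum:
  fixes m :: nat
  defines "F \<equiv> fourier q (\<lambda>g. q g ^ m)"
  shows "(\<Sum>h\<in>A. (B h g + cnj (B h g)) * (F h * cnj (F h)))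
    = of_nat CARD('g) * of_bool (nat_mult m g = 0) * q g ^ m
      - F 0 * cnj (F 0) - B g0 g * (F g0 * cnj (F g0))"
  unfolding F_def by (subst sum_A_B) (simp_all add: sum_B_fourier fourier_minus)

lemma sum_A_power_spectrum_0:
  fixes m :: nat
  defines "F \<equiv> fourier q (\<lambda>g. q g ^ m)"
  shows "2 * (\<Sum>h\<in>A. F h * cnj (F h))
    = of_nat CARD('g) - F 0 * cnj (F 0) - F g0 * cnj (F g0)"
  using sum_A_power_spectrum[of 0 m] by (simp add: F_def sum_distrib_left nat_mult_def)

text \<open>In the expansion of \<open>(z + inverse z) ^ 3\<close> the linear terms sum to zero
  because \<open>g \<noteq> 0\<close>, and the cubic ones detect \<open>3 g = 0\<close>. The fixed
  points \<open>0\<close> and \<open>g0\<close> account for the subtracted terms. This feeds the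
  fusion coefficients \<open>N3\<close>.\<close>

lemma sum_A_cube:
  assumes "g \<noteq> 0"
  shows "(\<Sum>h\<in>A. (B h g + cnj (B h g)) ^ 3) = of_nat CARD('g) * of_bool (nat_mult 3 g = 0) - 4 - 4 * B g0 g"
proof -
  have sum_inverse: "(\<Sum>h\<in>UNIV. inverse (B h g) ^ k) = (\<Sum>h\<in>UNIV. B h g ^ k)" for k
    by (rule sum.reindex_bij_witness[of _ uminus uminus]) (auto simp: B_minus_left)
  have cube: "(z + inverse z) ^ 3 = z ^ 3 + inverse z ^ 3 + 3 * z ^ 1 + 3 * inverse z ^ 1" if "z \<noteq> 0" for z :: complex
    using that by (simp add: field_simps power3_eq_cube)
  have "(\<Sum>h\<in>UNIV. (B h g + cnj (B h g)) ^ 3)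
    = (\<Sum>h\<in>UNIV. B h g ^ 3) + (\<Sum>h\<in>UNIV. inverse (B h g) ^ 3)
      + 3 * (\<Sum>h\<in>UNIV. B h g ^ 1) + 3 * (\<Sum>h\<in>UNIV. inverse (B h g) ^ 1)"
    by (simp only: cnj_B cube[OF B_nonzero] sum.distrib sum_distrib_left)
  also have "\<dots> = 2 * (of_nat CARD('g) * of_bool (nat_mult 3 g = 0))"
    unfolding sum_inverse using assms by (simp add: sum_B_power sum_B)
  finally have U: "(\<Sum>h\<in>UNIV. (B h g + cnj (B h g)) ^ 3) = \<dots>" .
  have "(B g0 g + B g0 g) ^ 3 = 8 * B g0 g"
    using B_g0_square[of g] by (simp add: power3_eq_cube)
  then show ?thesis
    using U by (subst sum_A) (simp_all add: B_minus_left cnj_B[of _ g] cnj_B_g0(1)[unfolded cnj_B] add.commute)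
qed

lemma sum_A_B_g0: "(\<Sum>h\<in>A. B h g0) = - (1 + B g0 g0) / 2"
proof -
  have "B (- h) g0 = B h g0" for h
    using cnj_B_g0(2)[of h] by (simp add: cnj_B B_minus_left)
  then show ?thesis
    by (subst sum_A) (simp_all add: sum_B)
qed

lemma card_A: "2 * of_nat (card A) = (of_nat CARD('g) - 2 :: complex)"
  using sum_A[of "\<lambda>_. 1"] by (simp add: mult.commute)

lemma A_nonzero: "g \<in> A \<Longrightarrow> g \<noteq> 0" and A_double: "g \<in> A \<Longrightarrow> nat_mult 2 g \<noteq> 0"
  using half_system by (auto simp: half_system_def two_torsion_def nat_mult_def numeral_2_eq_2 lessThan_Suc)

lemma nat_mult_g0: "nat_mult 2 g0 = 0" "nat_mult 3 g0 \<noteq> 0"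
  using g0_add_g0 by (simp_all add: nat_mult_def numeral_2_eq_2 numeral_3_eq_3 lessThan_Suc)

end

section \<open>The constants attached to the pair of metric groups\<close>

locale metric_group_pair =
  G: metric_group_halved q1 g0 Gs + H: metric_group_halved q2 \<gamma>0 \<Gamma>s
  for q1 :: "'g::{finite,ab_group_add} \<Rightarrow> complex" and g0 Gs
    and q2 :: "'h::{finite,ab_group_add} \<Rightarrow> complex" and \<gamma>0 \<Gamma>s +
  fixes n a b s u r :: complex
  assumes u_uminus: "bichar q1 g0 g0 = - bichar q2 \<gamma>0 \<gamma>0"
    and gauss_square: "(gauss_sum q1 1)\<^sup>2 = inverse (q1 g0) * q2 \<gamma>0"
    and card: "CARD('h) = CARD('g) + 2"
    and n_eq: "n = of_nat CARD('g)"
    and a_eq: "a = complex_of_real (1 / sqrt (real CARD('g)))"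
    and b_eq: "b = complex_of_real (1 / sqrt (real CARD('h)))"
    and s_eq: "s = s_const q1 q2 g0 \<gamma>0"
    and u_eq: "u = bichar q1 g0 g0"
    and r_eq: "r = complex_of_real (2 * sqrt 2)"
begin

abbreviation S where "S \<equiv> S_mat q1 q2 g0 \<gamma>0"
abbreviation J where "J \<equiv> J_set g0 \<gamma>0 Gs \<Gamma>s"

text \<open>The \<open>algebra\<close> steps below treat \<open>a\<close> and \<open>b\<close> as
  atoms and know them through this relation and \<open>b_square\<close>; the factor
  \<open>n + 2\<close> in the latter encodes the relation between the two group orders.\<close>

lemma a_square: "a * a * n = 1"
  unfolding a_eq n_eq by (simp add: field_simps flip: of_real_mult)

lemma b_square: "b * b * (n + 2) = 1"
proof -
  have "b * b * of_nat CARD('h) = 1"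
    unfolding b_eq by (simp add: field_simps flip: of_real_mult)
  then show ?thesis
    by (simp add: card n_eq add.commute)
qed

lemma cnj_a [simp]: "cnj a = a" and cnj_b [simp]: "cnj b = b"
  by (simp_all add: a_eq b_eq)

text \<open>The orders differ, so \<open>a * a \<noteq> b * b\<close>; thus no denominator
  \<open>S I_zero w\<close> with \<open>w\<close> in \<open>J\<close> vanishes.\<close>

lemma ab_nonzero [simp]: "a \<noteq> 0" "b \<noteq> 0" "a + b \<noteq> 0" "a - b \<noteq> 0" "a \<noteq> b"
proof -
  show "a \<noteq> 0" "b \<noteq> 0"
    using a_square b_square by auto
  have "a * a \<noteq> b * b"
  proof
    assume "a * a = b * b"
    then have "b * b * 2 = 0"
      using a_square b_square by (simp add: distrib_left)
    then show False
      using \<open>b \<noteq> 0\<close> by simp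
  qed
  then show "a + b \<noteq> 0" "a - b \<noteq> 0" "a \<noteq> b"
    by (auto simp: add_eq_0_iff)
qed

text \<open>\<open>K\<close> is \<open>1 / (a\<^sup>2 - b\<^sup>2)\<close>, written without denominators since \<open>n = 1 / a\<^sup>2\<close> and \<open>n + 2 = 1 / b\<^sup>2\<close>.\<close>

definition K :: complex where "K = n * (n + 2) / 2"

lemma inverse_ab: "inverse (a - b) = (a + b) * K" "inverse (a + b) = (a - b) * K"
proof -
  have "(a - b) * (a + b) * (n * (n + 2)) = 2"
    using a_square b_square by algebra
  then have "(a - b) * ((a + b) * K) = 1" "(a + b) * ((a - b) * K) = 1"
    by (simp_all add: K_def algebra_simps)
  then show "inverse (a - b) = (a + b) * K" "inverse (a + b) = (a - b) * K"
    by (metis inverse_unique)+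
qed

lemma u_q: "u = (q1 g0)\<^sup>2" "- u = (q2 \<gamma>0)\<^sup>2" "bichar q1 g0 g0 = u" "bichar q2 \<gamma>0 \<gamma>0 = - u"
  using u_uminus by (simp_all add: u_eq G.B_self H.B_self)

lemma u_square: "u * u = 1"
  using G.B_g0_square[of g0] by (simp add: u_eq)

lemma r_square: "r * r = 8" and r_nonzero [simp]: "r \<noteq> 0"
proof -
  have "complex_of_real (sqrt 2) * complex_of_real (sqrt 2) = 2"
    by (simp flip: of_real_mult)
  then show "r * r = 8"
    by (simp add: r_eq)
qed (simp add: r_eq)

text \<open>With \<open>x\<close> and \<open>y\<close> the inverses of \<open>q1 g0\<close> and
  \<open>q2 \<gamma>0\<close>, the squares \<open>u\<close> and \<open>- u\<close> cancel in
  \<open>(x + y)^2\<close>, leaving \<open>2 * x * y\<close>. As the squared Gauss sum is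
  \<open>x / y\<close>, what remains is \<open>x * x = u\<close>.\<close>

lemma s_square: "s * s = u"
proof -
  define x y z where "x = inverse (q1 g0)" and "y = inverse (q2 \<gamma>0)"
    and "z = complex_of_real (sqrt 2)"
  have z: "z * z = 2"
    by (simp add: z_def flip: of_real_mult)
  have "inverse u = u"
    using u_square by (simp add: inverse_unique)
  then have xy: "x * x = u" "y * y = - u"
    unfolding x_def y_def
    by (simp_all add: power_inverse u_q(1,2)[symmetric] flip: power2_eq_square)
  have "s * s = (gauss_sum q1 1)\<^sup>2 * ((x + y) * (x + y)) / (z * z)"
    unfolding s_eq s_const_def x_def y_def z_def by (simp add: power2_eq_square ac_simps)
  also have "(x + y) * (x + y) = 2 * (x * y)"
    by (simp add: xy algebra_simps)
  also have "(gauss_sum q1 1)\<^sup>2 * (2 * (x * y)) / (z * z) = x * x"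
    unfolding gauss_square by (simp add: z x_def y_def field_simps)
  finally show ?thesis
    by (simp add: xy)
qed

section \<open>Sums over the index set and the row sums of \<open>S\<close>\<close>

lemma sum_J:
  "(\<Sum>w\<in>J. f w) = f I_zero + f I_pi + (f (I_J1 g0 1) + f (I_J1 g0 (- 1))) + (\<Sum>g\<in>Gs. f (I_G g))
     + (f (I_J2 \<gamma>0 1) + f (I_J2 \<gamma>0 (- 1))) + (\<Sum>\<gamma>\<in>\<Gamma>s. f (I_Gamma \<gamma>))" for f :: "_ \<Rightarrow> complex"
proof -
  have "(\<Sum>w\<in>I_G ` Gs. f w) = (\<Sum>g\<in>Gs. f (I_G g))"
    "(\<Sum>w\<in>I_Gamma ` \<Gamma>s. f w) = (\<Sum>\<gamma>\<in>\<Gamma>s. f (I_Gamma \<gamma>))"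
    by (subst sum.reindex; simp add: inj_on_def)+
  \<comment> \<open>The signs are stored as complex numbers, so this keeps the two indices of each
    of \<open>J\<^sub>1\<close> and \<open>J\<^sub>2\<close> apart.\<close>
  moreover have "(1::complex) \<noteq> - 1"
    by simp
  ultimately show ?thesis
    unfolding J_set_def
    by (subst sum.union_disjoint; (simp; fail)?; force?)+
qed

lemma J_cases:
  assumes "w \<in> J"
  obtains "w = I_zero" | "w = I_pi" | \<epsilon> where "w = I_J1 g0 \<epsilon>" "\<epsilon> \<in> {1, - 1}"
    | g where "w = I_G g" "g \<in> Gs" | \<epsilon> where "w = I_J2 \<gamma>0 \<epsilon>" "\<epsilon> \<in> {1, - 1}"
    | \<gamma> where "w = I_Gamma \<gamma>" "\<gamma> \<in> \<Gamma>s"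
  using assms unfolding J_set_def by blast

lemmas S_eq = S_mat_def[of q1 q2 g0 \<gamma>0, unfolded Let_def, folded a_eq b_eq s_eq r_eq]

definition Y :: "('g \<Rightarrow> complex) \<Rightarrow> ('h \<Rightarrow> complex) \<Rightarrow> ('g, 'h) idx \<Rightarrow> complex" where
  "Y F H w = (case w of
     I_zero \<Rightarrow> (a * F 0 + b * H 0) / 2
   | I_pi \<Rightarrow> (a * F 0 - b * H 0) / 2
   | I_J1 _ _ \<Rightarrow> a / 2 * F g0
   | I_G g \<Rightarrow> a * F g
   | I_J2 _ _ \<Rightarrow> - (b / 2 * H \<gamma>0)
   | I_Gamma \<gamma> \<Rightarrow> - (b * H \<gamma>))"

text \<open>The terms of \<open>S w j\<close> containing \<open>s\<close> change sign with the sign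
  of \<open>j\<close> and cancel in pairs; the rest is \<open>fourier_half_system\<close>. Stating
  it for arbitrary even \<open>f\<close> and \<open>h\<close> covers positive and negative powers of
  \<open>T\<close>.\<close>

lemma sum_S_T:
  assumes f: "\<And>g. f (- g) = f g" "f 0 = 1" and h: "\<And>\<gamma>. h (- \<gamma>) = h \<gamma>" "h 0 = 1"
    and w: "w \<in> J"
  shows "(\<Sum>j\<in>J. S w j * S I_zero j * T_diag f h g0 \<gamma>0 j) = Y (fourier q1 f) (fourier q2 h) w"
proof -
  note F = G.fourier_half_system[of f, OF f(1), folded a_eq] and H = H.fourier_half_system[of h, OF h(1), folded b_eq]
  show ?thesis
    using w unfolding sum_J
    by (cases rule: J_cases)
      (simp_all add: S_eq Y_def F H f(2) h(2) u_q(3,4) sum_distrib_left sum.distrib sum_subtractf sum_negf field_simps)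
qed

lemma double_K: "2 * K = n * (n + 2)"
  by (simp add: K_def)

text \<open>The cancelling \<open>p\<close> and \<open>p'\<close> stand for the contributions of \<open>g\<^sub>0\<close> and \<open>\<gamma>\<^sub>0\<close>.\<close>

lemma poly_identity_G:
  "a * (a + b) * K * ((a * x + b * y) * (a * x' + b * y'))
    + a * (a - b) * K * ((a * x - b * y) * (a * x' - b * y')) + 2 * (a * a * p + a * a * (n * d - x * x' - p))
    = (x + y) * (x' + y') + 2 * d"
  using a_square b_square double_K by algebra

lemma poly_identity_H:
  "b * (a + b) * K * ((a * x + b * y) * (a * x' + b * y'))
    - b * (a - b) * K * ((a * x - b * y) * (a * x' - b * y')) - 2 * (b * b * p + b * b * ((n + 2) * d - y * y' - p))
    = (x + y) * (x' + y') - 2 * d"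
  using a_square b_square double_K by algebra

lemma poly_identity_pi:
  "(a + b) * (a + b) * K * ((a * x + b * y) * (a * x' + b * y'))
    + (a - b) * (a - b) * K * ((a * x - b * y) * (a * x' - b * y'))
    + 2 * (a * a * p + a * a * (n - x * x' - p)) - 2 * (b * b * p' + b * b * (n + 2 - y * y' - p'))
    = 2 * ((x + y) * (x' + y'))"
  using a_square b_square double_K by algebra

section \<open>The indicators as sums over the rows of \<open>S\<close>\<close>

abbreviation Fm where "Fm m \<equiv> fourier q1 (\<lambda>g. q1 g ^ m)"
abbreviation Hm where "Hm m \<equiv> fourier q2 (\<lambda>g. q2 g ^ m)"
abbreviation \<nu> where "\<nu> \<equiv> FS_indicator q1 q2 g0 \<gamma>0 Gs \<Gamma>s"

lemma FS_indicator_eq: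
  "\<nu> m k = (\<Sum>w\<in>J. S w (conj_idx q1 g0 k) / S I_zero w * (Y (Fm m) (Hm m) w * cnj (Y (Fm m) (Hm m) w)))"
proof -
  \<comment> \<open>The \<open>m\<close>-th power of the quotient of \<open>T\<close> entries splits
    into a factor in \<open>j\<close> and one in \<open>i\<close>. Both are values of
    \<open>T_diag\<close>, at \<open>m\<close>-th powers and at their inverses, so
    \<open>sum_S_T\<close> evaluates both row sums and they are conjugate.\<close>
  define t where "t = T_diag (\<lambda>g. q1 g ^ m) (\<lambda>g. q2 g ^ m) g0 \<gamma>0"
  define t' where "t' = T_diag (\<lambda>g. inverse (q1 g) ^ m) (\<lambda>g. inverse (q2 g) ^ m) g0 \<gamma>0"
  let ?k = "conj_idx q1 g0 k"
  have t: "(T_mat q1 q2 g0 \<gamma>0 j j / T_mat q1 q2 g0 \<gamma>0 i i) ^ m = t' i * t j" for i j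
    unfolding T_mat_def t_def t'_def
    by (cases i; cases j) (simp_all add: power_divide power_inverse field_simps)
  have Y: "(\<Sum>j\<in>J. S w j * S I_zero j * t j) = Y (Fm m) (Hm m) w"
    "(\<Sum>j\<in>J. S w j * S I_zero j * t' j) = cnj (Y (Fm m) (Hm m) w)" if "w \<in> J" for w
    unfolding t_def t'_def using that
    by (auto simp: sum_S_T Y_def G.fourier_inverse_q[abs_def] H.fourier_inverse_q[abs_def]
        simp del: inverse_eq_divide split: idx.split)
  have "\<nu> m k = (\<Sum>i\<in>J. \<Sum>j\<in>J. \<Sum>w\<in>J. 
      S w i * S w j * S w ?k / S I_zero w * S I_zero i * S I_zero j * (t' i * t j))"
    by (simp add: FS_indicator_def N_coeff_def Let_def t sum_distrib_right)
  also have "\<dots> = (\<Sum>w\<in>J. \<Sum>i\<in>J. \<Sum>j\<in>J. 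
      S w i * S w j * S w ?k / S I_zero w * S I_zero i * S I_zero j * (t' i * t j))"
    by (subst (2) sum.swap, subst sum.swap) (rule refl)
  also have "\<dots> = (\<Sum>w\<in>J. S w ?k / S I_zero w *
      ((\<Sum>j\<in>J. S w j * S I_zero j * t j) * (\<Sum>i\<in>J. S w i * S I_zero i * t' i)))"
  proof (rule sum.cong[OF refl])
    fix w
    show "(\<Sum>i\<in>J. \<Sum>j\<in>J. S w i * S w j * S w ?k / S I_zero w * S I_zero i * S I_zero j * (t' i * t j))
      = S w ?k / S I_zero w * ((\<Sum>j\<in>J. S w j * S I_zero j * t j) * (\<Sum>i\<in>J. S w i * S I_zero i * t' i))"
      by (subst sum.swap) (simp only: sum_product, simp add: sum_distrib_left ac_simps)
  qed
  finally show ?thesis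
    by (simp add: Y)
qed

text \<open>The denominators \<open>(a - b) / 2\<close> and \<open>(a + b) / 2\<close> become
  polynomial factors; all other \<open>S I_zero w\<close> are multiples of \<open>a\<close> or
  \<open>b\<close>.\<close>

lemma S_ratio:
  "S I_zero k / S I_zero I_zero = 2 * K * (a + b) * S I_zero k"
  "S I_pi k / S I_zero I_pi = 2 * K * (a - b) * S I_pi k"
proof -
  have "x / ((a - b) / 2) = 2 * K * (a + b) * x" "x / ((a + b) / 2) = 2 * K * (a - b) * x" for x
    using inverse_ab by (simp_all only: divide_inverse inverse_mult_distrib inverse_inverse_eq mult_ac)
  then show "S I_zero k / S I_zero I_zero = 2 * K * (a + b) * S I_zero k"
    "S I_pi k / S I_zero I_pi = 2 * K * (a - b) * S I_pi k"
    unfolding S_eq idx.case by blast+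
qed

lemma card_H: "of_nat CARD('h) = n + 2"
  by (simp add: n_eq card)

lemma sum_Gs_spectrum:
  "(\<Sum>h\<in>Gs. a * (bichar q1 h g + cnj (bichar q1 h g)) / a * (a * Fm m h * cnj (a * Fm m h)))
    = a * a * (n * (of_bool (nat_mult m g = 0) * q1 g ^ m) - Fm m 0 * cnj (Fm m 0)
       - bichar q1 g0 g * (Fm m g0 * cnj (Fm m g0)))"
proof -
  have "(\<Sum>h\<in>Gs. a * (bichar q1 h g + cnj (bichar q1 h g)) / a * (a * Fm m h * cnj (a * Fm m h)))
    = a * a * (\<Sum>h\<in>Gs. (bichar q1 h g + cnj (bichar q1 h g)) * (Fm m h * cnj (Fm m h)))"
    by (simp add: sum_distrib_left ac_simps)
  then show ?thesis
    by (simp add: G.sum_A_power_spectrum n_eq mult.assoc)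
qed

lemma sum_\<Gamma>s_spectrum:
  "(\<Sum>h\<in>\<Gamma>s. b * (bichar q2 h \<gamma> + cnj (bichar q2 h \<gamma>)) / b * (b * Hm m h * cnj (b * Hm m h)))
    = b * b * ((n + 2) * (of_bool (nat_mult m \<gamma> = 0) * q2 \<gamma> ^ m) - Hm m 0 * cnj (Hm m 0)
       - bichar q2 \<gamma>0 \<gamma> * (Hm m \<gamma>0 * cnj (Hm m \<gamma>0)))"
proof -
  have "(\<Sum>h\<in>\<Gamma>s. b * (bichar q2 h \<gamma> + cnj (bichar q2 h \<gamma>)) / b * (b * Hm m h * cnj (b * Hm m h)))
    = b * b * (\<Sum>h\<in>\<Gamma>s. (bichar q2 h \<gamma> + cnj (bichar q2 h \<gamma>)) * (Hm m h * cnj (Hm m h)))"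
    by (simp add: sum_distrib_left ac_simps)
  then show ?thesis
    by (simp only: H.sum_A_power_spectrum card_H mult.assoc)
qed

lemma conj_idx_J: "conj_idx q1 g0 (I_J1 g \<epsilon>) = I_J1 g (u * \<epsilon>)" "conj_idx q1 g0 (I_J2 \<gamma> \<epsilon>) = I_J2 \<gamma> (u * \<epsilon>)"
  by (simp_all add: u_eq)

text \<open>Kept as a product because the polynomial identities treat a number and its conjugate as
  independent variables.\<close>

definition gauss_gram :: "nat \<Rightarrow> complex" where
  "gauss_gram m = (Fm m 0 + Hm m 0) * (cnj (Fm m 0) + cnj (Hm m 0))"

lemma gauss_gram_eq: "gauss_gram m = complex_of_real ((norm (gauss_sum q1 m + gauss_sum q2 m))\<^sup>2)"
  unfolding gauss_gram_def G.fourier_zero H.fourier_zero complex_norm_square by simp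

text \<open>Column \<open>I_G g\<close> of \<open>S\<close> vanishes on the rows of
  \<open>J\<^sub>2\<close> and \<open>\<Gamma>s\<close>, so the second group enters through the rows
  \<open>I_zero\<close> and \<open>I_pi\<close> alone.\<close>

lemma indicator_G: "2 * \<nu> m (I_G g) = gauss_gram m + 2 * (of_bool (nat_mult m g = 0) * q1 g ^ m)"
proof -
  have "2 * \<nu> m (I_G g) = a * (a + b) * K * ((a * Fm m 0 + b * Hm m 0) * (a * cnj (Fm m 0) + b * cnj (Hm m 0)))
    + a * (a - b) * K * ((a * Fm m 0 - b * Hm m 0) * (a * cnj (Fm m 0) - b * cnj (Hm m 0)))
    + 2 * (a * a * (bichar q1 g0 g * (Fm m g0 * cnj (Fm m g0)))
      + (\<Sum>h\<in>Gs. a * (bichar q1 h g + cnj (bichar q1 h g)) / a * (a * Fm m h * cnj (a * Fm m h))))"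
    unfolding FS_indicator_eq sum_J S_ratio
    by (simp add: S_eq Y_def sum_distrib_left field_simps)
  then show ?thesis
    by (simp only: sum_Gs_spectrum poly_identity_G gauss_gram_def)
qed

text \<open>Up to terms odd in the sign of the row, which cancel in pairs, the column is half of
  what the formula for \<open>I_G\<close> would give at \<open>g0\<close>. Conjugation alters only
  the sign and so has no effect.\<close>

lemma indicator_J1: "4 * \<nu> m (I_J1 g0 \<epsilon>) = gauss_gram m + 2 * (of_bool (nat_mult m g0 = 0) * q1 g0 ^ m)"
proof -
  have "4 * \<nu> m (I_J1 g0 \<epsilon>) = a * (a + b) * K * ((a * Fm m 0 + b * Hm m 0) * (a * cnj (Fm m 0) + b * cnj (Hm m 0)))
    + a * (a - b) * K * ((a * Fm m 0 - b * Hm m 0) * (a * cnj (Fm m 0) - b * cnj (Hm m 0)))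
    + 2 * (a * a * (bichar q1 g0 g0 * (Fm m g0 * cnj (Fm m g0)))
      + (\<Sum>h\<in>Gs. a * (bichar q1 h g0 + cnj (bichar q1 h g0)) / a * (a * Fm m h * cnj (a * Fm m h))))"
    unfolding FS_indicator_eq sum_J conj_idx_J S_ratio
    by (simp add: S_eq Y_def sum_distrib_left field_simps)
  then show ?thesis
    by (simp only: sum_Gs_spectrum poly_identity_G gauss_gram_def)
qed

text \<open>Compared with \<open>I_G\<close>, the entry in row \<open>I_pi\<close> and the block
  over \<open>\<Gamma>s\<close> are negative, whence the two minus signs.\<close>

lemma indicator_Gamma: "2 * \<nu> m (I_Gamma \<gamma>) = gauss_gram m - 2 * (of_bool (nat_mult m \<gamma> = 0) * q2 \<gamma> ^ m)"
proof -
  have "2 * \<nu> m (I_Gamma \<gamma>) = b * (a + b) * K * ((a * Fm m 0 + b * Hm m 0) * (a * cnj (Fm m 0) + b * cnj (Hm m 0)))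
    - b * (a - b) * K * ((a * Fm m 0 - b * Hm m 0) * (a * cnj (Fm m 0) - b * cnj (Hm m 0)))
    - 2 * (b * b * (bichar q2 \<gamma>0 \<gamma> * (Hm m \<gamma>0 * cnj (Hm m \<gamma>0)))
      + (\<Sum>h\<in>\<Gamma>s. b * (bichar q2 h \<gamma> + cnj (bichar q2 h \<gamma>)) / b * (b * Hm m h * cnj (b * Hm m h))))"
    unfolding FS_indicator_eq sum_J S_ratio
    by (simp add: S_eq Y_def sum_distrib_left algebra_simps add_divide_distrib diff_divide_distrib
      sum.distrib sum_subtractf sum_negf)
  then show ?thesis
    by (simp only: sum_\<Gamma>s_spectrum poly_identity_H gauss_gram_def)
qed

lemma indicator_J2: "4 * \<nu> m (I_J2 \<gamma>0 \<epsilon>) = gauss_gram m - 2 * (of_bool (nat_mult m \<gamma>0 = 0) * q2 \<gamma>0 ^ m)"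
proof -
  have "4 * \<nu> m (I_J2 \<gamma>0 \<epsilon>) = b * (a + b) * K * ((a * Fm m 0 + b * Hm m 0) * (a * cnj (Fm m 0) + b * cnj (Hm m 0)))
    - b * (a - b) * K * ((a * Fm m 0 - b * Hm m 0) * (a * cnj (Fm m 0) - b * cnj (Hm m 0)))
    - 2 * (b * b * (bichar q2 \<gamma>0 \<gamma>0 * (Hm m \<gamma>0 * cnj (Hm m \<gamma>0)))
      + (\<Sum>h\<in>\<Gamma>s. b * (bichar q2 h \<gamma>0 + cnj (bichar q2 h \<gamma>0)) / b * (b * Hm m h * cnj (b * Hm m h))))"
    unfolding FS_indicator_eq sum_J conj_idx_J S_ratio
    by (simp add: S_eq Y_def sum_distrib_left sum_negf sum_subtractf sum.distrib field_simps)
  then show ?thesis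
    by (simp only: sum_\<Gamma>s_spectrum poly_identity_H gauss_gram_def)
qed

lemma double_sum_Gs_spectrum:
  "2 * (\<Sum>h\<in>Gs. a * Fm m h * cnj (a * Fm m h))
    = a * a * (n - Fm m 0 * cnj (Fm m 0) - Fm m g0 * cnj (Fm m g0))"
proof -
  have "2 * (\<Sum>h\<in>Gs. a * Fm m h * cnj (a * Fm m h)) = a * a * (2 * (\<Sum>h\<in>Gs. Fm m h * cnj (Fm m h)))"
    by (simp add: sum_distrib_left ac_simps)
  then show ?thesis
    by (simp only: G.sum_A_power_spectrum_0 n_eq)
qed

lemma double_sum_\<Gamma>s_spectrum:
  "2 * (\<Sum>h\<in>\<Gamma>s. b * Hm m h * cnj (b * Hm m h))
    = b * b * (n + 2 - Hm m 0 * cnj (Hm m 0) - Hm m \<gamma>0 * cnj (Hm m \<gamma>0))"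
proof -
  have "2 * (\<Sum>h\<in>\<Gamma>s. b * Hm m h * cnj (b * Hm m h)) = b * b * (2 * (\<Sum>h\<in>\<Gamma>s. Hm m h * cnj (Hm m h)))"
    by (simp add: sum_distrib_left ac_simps)
  then show ?thesis
    by (simp only: H.sum_A_power_spectrum_0 card_H)
qed

text \<open>The quotient \<open>S w I_pi / S I_zero w\<close> is \<open>1\<close> on the rows from
  \<open>G\<close>, \<open>-1\<close> on those from \<open>\<Gamma>\<close>, and carries
  \<open>K\<close> on the rows \<open>I_zero\<close> and \<open>I_pi\<close>.\<close>

lemma indicator_pi: "2 * \<nu> m I_pi = gauss_gram m"
proof -
  have "4 * \<nu> m I_pi = (a + b) * (a + b) * K * ((a * Fm m 0 + b * Hm m 0) * (a * cnj (Fm m 0) + b * cnj (Hm m 0)))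
    + (a - b) * (a - b) * K * ((a * Fm m 0 - b * Hm m 0) * (a * cnj (Fm m 0) - b * cnj (Hm m 0)))
    + 2 * (a * a * (Fm m g0 * cnj (Fm m g0)) + 2 * (\<Sum>h\<in>Gs. a * Fm m h * cnj (a * Fm m h)))
    - 2 * (b * b * (Hm m \<gamma>0 * cnj (Hm m \<gamma>0)) + 2 * (\<Sum>h\<in>\<Gamma>s. b * Hm m h * cnj (b * Hm m h)))"
    unfolding FS_indicator_eq sum_J S_ratio
    by (simp add: S_eq Y_def sum_distrib_left sum_negf field_simps)
  also have "\<dots> = 2 * gauss_gram m"
    by (simp only: double_sum_Gs_spectrum double_sum_\<Gamma>s_spectrum poly_identity_pi gauss_gram_def)
  finally show ?thesis
    by simp
qed

text \<open>All quotients \<open>S w I_zero / S I_zero w\<close> are \<open>1\<close>, so this is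
  Parseval on both groups. It is wanted because (FS2) and (FS3) range over all of
  \<open>J\<close>.\<close>

lemma indicator_zero: "\<nu> m I_zero = 1"
proof -
  have "2 * \<nu> m I_zero = a * a * (Fm m 0 * cnj (Fm m 0)) + b * b * (Hm m 0 * cnj (Hm m 0))
    + (a * a * (Fm m g0 * cnj (Fm m g0)) + 2 * (\<Sum>h\<in>Gs. a * Fm m h * cnj (a * Fm m h)))
    + (b * b * (Hm m \<gamma>0 * cnj (Hm m \<gamma>0)) + 2 * (\<Sum>h\<in>\<Gamma>s. b * Hm m h * cnj (b * Hm m h)))"
    unfolding FS_indicator_eq sum_J
    by (simp add: S_eq Y_def sum_distrib_left field_simps)
  also have "\<dots> = a * a * n + b * b * (n + 2)"
    unfolding double_sum_Gs_spectrum double_sum_\<Gamma>s_spectrum by (simp add: algebra_simps)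
  finally show ?thesis
    by (simp add: a_square b_square)
qed

section \<open>The fusion coefficients with three equal indices\<close>

abbreviation N3 where "N3 k \<equiv> N_coeff q1 q2 g0 \<gamma>0 Gs \<Gamma>s k k k"

lemma N3_eq: "N3 k = (\<Sum>w\<in>J. S w k / S I_zero w * (S w k * S w k))"
  by (simp add: N_coeff_def Let_def ac_simps)

lemma card_Gs: "2 * of_nat (card Gs) = n - 2" and card_\<Gamma>s: "2 * of_nat (card \<Gamma>s) = n"
  using G.card_A H.card_A by (simp_all add: n_eq card)

lemma N3_zero: "N3 I_zero = 1"
proof -
  have "4 * N3 I_zero = (a - b) * (a - b) + (a + b) * (a + b) + 2 * a * a + 2 * (2 * of_nat (card Gs)) * a * a
    + 2 * b * b + 2 * (2 * of_nat (card \<Gamma>s)) * b * b"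
    unfolding N3_eq sum_J by (simp add: S_eq field_simps)
  also have "\<dots> = 4"
    unfolding card_Gs card_\<Gamma>s using a_square b_square by algebra
  finally show ?thesis
    by simp
qed

lemma N3_pi: "N3 I_pi = 2"
proof -
  have "4 * N3 I_pi = K * (a + b) ^ 4 + K * (a - b) ^ 4 + 2 * a * a + 2 * (2 * of_nat (card Gs)) * a * a
    - 2 * b * b - 2 * (2 * of_nat (card \<Gamma>s)) * b * b"
    unfolding N3_eq sum_J S_ratio by (simp add: S_eq field_simps power4_eq_xxxx)
  also have "\<dots> = 8"
    unfolding card_Gs card_\<Gamma>s using a_square b_square double_K by algebra
  finally show ?thesis
    by simp
qed

text \<open>The rows \<open>I_zero\<close> and \<open>I_pi\<close> give
  \<open>4 * K * a ^ 4 = 2 + 4 * a * a\<close>; the corrections in \<open>sum_A_cube\<close> cancel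
  this excess and the contribution of \<open>J\<^sub>1\<close>.\<close>

lemma N3_G:
  assumes "g \<in> Gs"
  shows "N3 (I_G g) = 2 + of_bool (nat_mult 3 g = 0)"
proof -
  let ?\<beta> = "bichar q1 g0 g"
  have "N3 (I_G g) = 4 * K * a ^ 4 + 4 * a * a * (?\<beta> * ?\<beta>) * ?\<beta>
      + a * a * (\<Sum>h\<in>Gs. (bichar q1 h g + cnj (bichar q1 h g)) ^ 3)"
    unfolding N3_eq sum_J S_ratio
    by (simp add: S_eq sum_distrib_left power3_eq_cube power4_eq_xxxx algebra_simps
        add_divide_distrib)
  also have "\<dots> = 2 + of_bool (nat_mult 3 g = 0)"
    unfolding G.B_g0_square G.sum_A_cube[OF G.A_nonzero[OF assms]] n_eq[symmetric]
    using a_square double_K by algebra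
  finally show ?thesis .
qed

lemma N3_Gamma:
  assumes "\<gamma> \<in> \<Gamma>s"
  shows "N3 (I_Gamma \<gamma>) = 2 - of_bool (nat_mult 3 \<gamma> = 0)"
proof -
  let ?\<beta> = "bichar q2 \<gamma>0 \<gamma>"
  have "N3 (I_Gamma \<gamma>) = 4 * K * b ^ 4 - 4 * b * b * (?\<beta> * ?\<beta>) * ?\<beta>
      - b * b * (\<Sum>h\<in>\<Gamma>s. (bichar q2 h \<gamma> + cnj (bichar q2 h \<gamma>)) ^ 3)"
    unfolding N3_eq sum_J S_ratio
    by (simp add: S_eq sum_distrib_left power3_eq_cube power4_eq_xxxx algebra_simps
        add_divide_distrib diff_divide_distrib sum.distrib sum_subtractf sum_negf)
  also have "\<dots> = 2 - of_bool (nat_mult 3 \<gamma> = 0)"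
    unfolding H.B_g0_square H.sum_A_cube[OF H.A_nonzero[OF assms]] card_H
    using b_square double_K by algebra
  finally show ?thesis .
qed

text \<open>The joint contribution of the two rows with signs \<open>1\<close> and
  \<open>-1\<close>: odd powers of \<open>e\<close> cancel and \<open>e * e\<close> is known. The
  factors \<open>1 * e\<close> and \<open>- 1 * e\<close> stay unsimplified to match the entries of
  \<open>S\<close> literally.\<close>

lemma cube_sum:
  assumes "x \<noteq> 0" "8 * (e * e) = u" "v * v = 1" "v * u = w"
  shows "(x / 2 + 1 * e) * v / (x / 2) * ((x / 2 + 1 * e) * v * ((x / 2 + 1 * e) * v))
      + (x / 2 + - 1 * e) * v / (x / 2) * ((x / 2 + - 1 * e) * v * ((x / 2 + - 1 * e) * v))
    = (2 * v * (x * x) + 3 * w) / 4" (is "?A + ?B = _")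
proof -
  have "x * (?A + ?B) = 2 * (v * v) * v * ((x / 2 + e) ^ 3 + (x / 2 - e) ^ 3)"
    using assms(1) by (simp add: field_simps power3_eq_cube)
  also have "(x / 2 + e) ^ 3 + (x / 2 - e) ^ 3 = x * (x * x + 12 * (e * e)) / 4"
    by (simp add: field_simps power3_eq_cube)
  finally have "x * (4 * (?A + ?B)) = x * (2 * v * (x * x) + 3 * (v * (8 * (e * e))))"
    by (simp add: assms(3) algebra_simps)
  then have "4 * (?A + ?B) = 2 * v * (x * x) + 3 * w"
    using assms by simp
  then show ?thesis
    by (simp only: eq_divide_eq_numeral1 mult.commute) simp
qed

lemma e_square: "\<epsilon> \<in> {1, - 1} \<Longrightarrow> 8 * ((\<epsilon> * s / r) * (\<epsilon> * s / r)) = u"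
  using s_square r_square r_nonzero by (auto simp: field_simps)

lemma N3_J1:
  assumes "\<epsilon> \<in> {1, - 1}"
  shows "N3 (I_J1 g0 \<epsilon>) = 1"
proof -
  define e where "e = \<epsilon> * s / r"
  have S: "S (I_J1 g0 \<epsilon>') (I_J1 g0 \<epsilon>) = (a / 2 + \<epsilon>' * e) * u" "S I_zero (I_J1 g0 \<epsilon>') = a / 2"
    "S I_pi (I_J1 g0 \<epsilon>') = a / 2" "S (I_G g) (I_J1 g0 \<epsilon>) = a * bichar q1 g g0" "S I_zero (I_G g) = a"
    "S (I_J2 \<gamma>0 \<epsilon>') (I_J1 g0 \<epsilon>) = \<epsilon>' * e" "S I_zero (I_J2 \<gamma>0 \<epsilon>') = b / 2" "S (I_Gamma \<gamma>) (I_J1 g0 \<epsilon>) = 0" for \<epsilon>' g \<gamma>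
    by (simp_all add: S_eq e_def u_q(3))
  note cube = cube_sum[OF ab_nonzero(1) e_square[OF assms, folded e_def] u_square u_square]
  have "bichar q1 g g0 * bichar q1 g g0 = 1" for g
    using G.B_g0_square G.B_commute by metis
  then have "(\<Sum>g\<in>Gs. a * bichar q1 g g0 / a * (a * bichar q1 g g0 * (a * bichar q1 g g0)))
      = a * a * (\<Sum>g\<in>Gs. bichar q1 g g0)"
    unfolding sum_distrib_left by (intro sum.cong refl) (simp add: ac_simps)
  also have "\<dots> = - (a * a * (1 + u) / 2)"
    unfolding G.sum_A_B_g0 u_q(3) by (simp add: algebra_simps)
  finally have sum: "(\<Sum>g\<in>Gs. a * bichar q1 g g0 / a * (a * bichar q1 g g0 * (a * bichar q1 g g0)))
      = - (a * a * (1 + u) / 2)" .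
  have "N3 (I_J1 g0 \<epsilon>) = 2 * K * (a * a * a * a) / 4 + (2 * u * (a * a) + 3) / 4 - a * a * (1 + u) / 2"
    unfolding N3_eq sum_J S_ratio
    by (simp only: S cube sum) (simp add: algebra_simps)
  also have "2 * K * (a * a * a * a) = 1 + 2 * (a * a)"
    using a_square double_K by algebra
  finally show ?thesis
    by (simp add: field_simps)
qed

lemma N3_J2:
  assumes "\<epsilon> \<in> {1, - 1}"
  shows "N3 (I_J2 \<gamma>0 \<epsilon>) = 1"
proof -
  \<comment> \<open>The block entry is
    \<open>- (b / 2 - \<epsilon>' * \<epsilon> * s / r) * (- u)\<close>; putting the inner sign into
    \<open>e\<close> brings it into the form of \<open>cube_sum\<close>.\<close>
  define e where "e = - (\<epsilon> * s / r)"
  have S: "S (I_J2 \<gamma>0 \<epsilon>') (I_J2 \<gamma>0 \<epsilon>) = (b / 2 + \<epsilon>' * e) * u" "S I_zero (I_J2 \<gamma>0 \<epsilon>') = b / 2"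
    "S I_pi (I_J2 \<gamma>0 \<epsilon>') = - (b / 2)" "S (I_Gamma \<gamma>) (I_J2 \<gamma>0 \<epsilon>) = - b * bichar q2 \<gamma> \<gamma>0"
    "S I_zero (I_Gamma \<gamma>) = b"
    "S (I_J1 g0 \<epsilon>') (I_J2 \<gamma>0 \<epsilon>) = - (\<epsilon>' * e)" "S I_zero (I_J1 g0 \<epsilon>') = a / 2" "S (I_G g) (I_J2 \<gamma>0 \<epsilon>) = 0" for \<epsilon>' g \<gamma>
    by (simp_all add: S_eq e_def u_q(4) algebra_simps)
  have "8 * (e * e) = u"
    using e_square[OF assms] by (simp add: e_def)
  note cube = cube_sum[OF ab_nonzero(2) this u_square u_square]
  have "bichar q2 \<gamma> \<gamma>0 * bichar q2 \<gamma> \<gamma>0 = 1" for \<gamma>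
    using H.B_g0_square H.B_commute by metis
  then have "(\<Sum>\<gamma>\<in>\<Gamma>s. - b * bichar q2 \<gamma> \<gamma>0 / b * (- b * bichar q2 \<gamma> \<gamma>0 * (- b * bichar q2 \<gamma> \<gamma>0)))
      = - (b * b) * (\<Sum>\<gamma>\<in>\<Gamma>s. bichar q2 \<gamma> \<gamma>0)"
    unfolding sum_distrib_left by (intro sum.cong refl) (simp add: ac_simps)
  also have "\<dots> = b * b * (1 - u) / 2"
    unfolding H.sum_A_B_g0 u_q(4) by (simp add: algebra_simps)
  finally have sum: "(\<Sum>\<gamma>\<in>\<Gamma>s. - b * bichar q2 \<gamma> \<gamma>0 / b * (- b * bichar q2 \<gamma> \<gamma>0 * (- b * bichar q2 \<gamma> \<gamma>0)))
      = b * b * (1 - u) / 2" .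
  have "N3 (I_J2 \<gamma>0 \<epsilon>) = 2 * K * (b * b * b * b) / 4 + (2 * u * (b * b) + 3) / 4 + b * b * (1 - u) / 2"
    unfolding N3_eq sum_J S_ratio
    by (simp only: S cube sum) (simp add: algebra_simps)
  also have "2 * K * (b * b * b * b) = 1 - 2 * (b * b)"
    using b_square double_K by algebra
  finally show ?thesis
    by (simp add: field_simps)
qed

section \<open>The indicator formulas and the conditions (FS2) and (FS3)\<close>

lemma indicators:
  defines "P m \<equiv> (norm (gauss_sum q1 m + gauss_sum q2 m))\<^sup>2"
  shows "\<nu> m I_pi = complex_of_real (1/2 * P m)"
    "\<nu> m (I_J1 g0 \<epsilon>) = complex_of_real (1/4 * P m) + 1/2 * of_bool (nat_mult m g0 = 0) * q1 g0 ^ m"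
    "\<nu> m (I_G g) = complex_of_real (1/2 * P m) + of_bool (nat_mult m g = 0) * q1 g ^ m"
    "\<nu> m (I_J2 \<gamma>0 \<epsilon>) = complex_of_real (1/4 * P m) - 1/2 * of_bool (nat_mult m \<gamma>0 = 0) * q2 \<gamma>0 ^ m"
    "\<nu> m (I_Gamma \<gamma>) = complex_of_real (1/2 * P m) - of_bool (nat_mult m \<gamma> = 0) * q2 \<gamma> ^ m"
proof -
  have half: "x = y / 2 + d" if "2 * x = y + 2 * d" for x y d :: complex
    using that by (auto simp: field_simps)
  have quarter: "x = y / 4 + d / 2" if "4 * x = y + 2 * d"
    for x y d :: complex
    using that by (auto simp: field_simps)
  note eq = gauss_gram_eq[folded P_def]
  show "\<nu> m I_pi = complex_of_real (1/2 * P m)"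
    using indicator_pi[of m] by (simp add: eq field_simps)
  show "\<nu> m (I_J1 g0 \<epsilon>) = complex_of_real (1/4 * P m) + 1/2 * of_bool (nat_mult m g0 = 0) * q1 g0 ^ m"
    using quarter[OF indicator_J1] by (simp add: eq)
  show "\<nu> m (I_G g) = complex_of_real (1/2 * P m) + of_bool (nat_mult m g = 0) * q1 g ^ m"
    using half[OF indicator_G] by (simp add: eq)
  show "\<nu> m (I_J2 \<gamma>0 \<epsilon>) = complex_of_real (1/4 * P m) - 1/2 * of_bool (nat_mult m \<gamma>0 = 0) * q2 \<gamma>0 ^ m"
    using quarter[of _ _ "- (of_bool (nat_mult m \<gamma>0 = 0) * q2 \<gamma>0 ^ m)"] indicator_J2[of m \<epsilon>] by (simp add: eq)
  show "\<nu> m (I_Gamma \<gamma>) = complex_of_real (1/2 * P m) - of_bool (nat_mult m \<gamma> = 0) * q2 \<gamma> ^ m"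
    using half[of _ _ "- (of_bool (nat_mult m \<gamma> = 0) * q2 \<gamma> ^ m)"] indicator_Gamma[of m \<gamma>] by (simp add: eq)
qed

text \<open>The index \<open>I_pi\<close> decides one direction: its indicator \<open>P / 2\<close>
  is nonnegative, so being a sign means \<open>P = 2\<close>.\<close>

lemma FS2_iff: "FS2 q1 q2 g0 \<gamma>0 Gs \<Gamma>s \<longleftrightarrow> norm (gauss_sum q1 2 + gauss_sum q2 2) = sqrt 2"
proof -
  define P where "P = (norm (gauss_sum q1 2 + gauss_sum q2 2))\<^sup>2"
  have P: "norm (gauss_sum q1 2 + gauss_sum q2 2) = sqrt 2 \<longleftrightarrow> P = 2"
    by (metis P_def norm_ge_zero real_sqrt_pow2 real_sqrt_unique zero_le_numeral)
  note ind = indicators[of 2, folded P_def]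
  show ?thesis
  proof
    assume "FS2 q1 q2 g0 \<gamma>0 Gs \<Gamma>s"
    then have "\<nu> 2 I_pi \<in> {1, - 1}"
      by (simp add: FS2_def J_set_def)
    then have "complex_of_real (P / 2) = complex_of_real 1 \<or> complex_of_real (P / 2) = complex_of_real (- 1)"
      by (simp add: ind)
    then have "P / 2 = 1 \<or> P / 2 = - 1"
      by (simp only: of_real_eq_iff)
    moreover have "P \<ge> 0"
      by (simp add: P_def)
    ultimately show "norm (gauss_sum q1 2 + gauss_sum q2 2) = sqrt 2"
      unfolding P by auto
  next
    assume "norm (gauss_sum q1 2 + gauss_sum q2 2) = sqrt 2"
    then have "P = 2"
      unfolding P .
    then have \<nu>: "\<nu> 2 I_pi = 1" "\<nu> 2 (I_J1 g0 \<epsilon>) = (1 + u) / 2" "\<nu> 2 (I_J2 \<gamma>0 \<epsilon>) = (1 + u) / 2"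
      "g \<in> Gs \<Longrightarrow> \<nu> 2 (I_G g) = 1" "\<gamma> \<in> \<Gamma>s \<Longrightarrow> \<nu> 2 (I_Gamma \<gamma>) = 1" for \<epsilon> g \<gamma>
      by (simp_all add: ind G.nat_mult_g0 H.nat_mult_g0 G.A_double H.A_double add_divide_distrib
          flip: u_q(1,2))
    \<comment> \<open>For \<open>u = 1\<close> every index is self-conjugate and
      \<open>(1 + u) / 2 = 1\<close>; for \<open>u = - 1\<close> conjugation swaps the signs in
      \<open>J\<^sub>1\<close> and \<open>J\<^sub>2\<close>, where the indicator is
      \<open>0\<close>.\<close>
    have "u = 1 \<or> u = - 1"
      using u_square by (simp add: square_eq_1_iff)
    then show "FS2 q1 q2 g0 \<gamma>0 Gs \<Gamma>s"
      unfolding FS2_def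
      by (auto elim!: J_cases simp: \<nu> indicator_zero conj_idx_J simp del: conj_idx.simps(1,2))
  qed
qed

lemma FS3_iff: "FS3 q1 q2 g0 \<gamma>0 Gs \<Gamma>s \<longleftrightarrow> norm (gauss_sum q1 3 + gauss_sum q2 3) = 2"
proof -
  define P where "P = (norm (gauss_sum q1 3 + gauss_sum q2 3))\<^sup>2"
  have P: "norm (gauss_sum q1 3 + gauss_sum q2 3) = 2 \<longleftrightarrow> P = 4"
    using power2_eq_iff_nonneg[of "norm (gauss_sum q1 3 + gauss_sum q2 3)" 2] by (simp add: P_def)
  note ind = indicators[of 3, folded P_def]
  define \<omega> where "\<omega> = exp (2 * of_real pi * \<i> / 3)"
  define \<omega>' where "\<omega>' = exp (4 * of_real pi * \<i> / 3)"
  have \<omega>: "\<omega> = Complex (- 1 / 2) (sqrt 3 / 2)"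
    unfolding \<omega>_def complex_eq_iff by (simp add: Re_exp Im_exp cos_120 sin_120)
  have "\<omega>' = \<omega> * \<omega>"
    by (simp add: \<omega>_def \<omega>'_def algebra_simps flip: exp_add)
  then have \<omega>': "\<omega>' = Complex (- 1 / 2) (- (sqrt 3 / 2))"
    by (simp add: \<omega> complex_eq_iff field_simps)
  show ?thesis
  proof
    assume "FS3 q1 q2 g0 \<gamma>0 Gs \<Gamma>s"
    then obtain zs where zs: "of_nat (length zs) = (2 :: complex)" "set zs \<subseteq> {1, \<omega>, \<omega>'}" "\<nu> 3 I_pi = sum_list zs"
      unfolding FS3_def \<omega>_def \<omega>'_def by (metis (no_types, lifting) J_set_def N3_pi UnCI insertI1 insertI2)
    from zs(1) have "length zs = 2"
      by (metis of_nat_eq_iff of_nat_numeral)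
    then obtain x y where xy: "zs = [x, y]"
      by (auto simp: numeral_2_eq_2 length_Suc_conv)
    have "complex_of_real (P / 2) = x + y"
      using zs(3) by (simp add: ind xy)
    then have "P / 2 = Re (x + y)" "0 = Im (x + y)"
      by (metis Re_complex_of_real, metis Im_complex_of_real)
    moreover have "P \<ge> 0"
      by (simp add: P_def)
    \<comment> \<open>Among the sums of two cube roots of unity only \<open>2\<close> and
      \<open>\<omega> + \<omega>' = - 1\<close> are real, and \<open>P \<ge> 0\<close> excludes the
      latter.\<close>
    ultimately show "norm (gauss_sum q1 3 + gauss_sum q2 3) = 2"
      unfolding P using zs(2) by (auto simp: xy \<omega> \<omega>')
  next
    assume "norm (gauss_sum q1 3 + gauss_sum q2 3) = 2"
    then have "P = 4"
      unfolding P .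
    \<comment> \<open>Equality with one natural number \<open>j\<close> lets a list of
      \<open>j\<close> ones serve as the witness in (FS3).\<close>
    have "\<exists>j. N3 k = of_nat j \<and> \<nu> 3 k = of_nat j" if "k \<in> J" for k
      using that
    proof (cases rule: J_cases)
      case 1
      then show ?thesis
        by (intro exI[of _ 1]) (simp add: N3_zero indicator_zero)
    next
      case 2
      then show ?thesis
        by (intro exI[of _ 2]) (simp add: N3_pi ind \<open>P = 4\<close>)
    next
      case (3 \<epsilon>)
      then show ?thesis
        by (intro exI[of _ 1]) (simp add: N3_J1 ind G.nat_mult_g0 \<open>P = 4\<close>)
    next
      case (4 g)
      then show ?thesis
        by (intro exI[of _ "2 + of_bool (nat_mult 3 g = 0)"]) (simp add: N3_G ind G.q_cube \<open>P = 4\<close>)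
    next
      case (5 \<epsilon>)
      then show ?thesis
        by (intro exI[of _ 1]) (simp add: N3_J2 ind H.nat_mult_g0 \<open>P = 4\<close>)
    next
      case (6 \<gamma>)
      then show ?thesis
        by (intro exI[of _ "2 - of_bool (nat_mult 3 \<gamma> = 0)"]) (simp add: N3_Gamma ind H.q_cube \<open>P = 4\<close>)
    qed
    then show "FS3 q1 q2 g0 \<gamma>0 Gs \<Gamma>s"
      unfolding FS3_def
      by (metis length_replicate set_replicate_conv_if empty_subsetI insert_subset insertI1
          sum_list_replicate mult.right_neutral)
  qed
qed

end

theorem lemma4p7:
  fixes q1 :: "'g::{finite,ab_group_add} \<Rightarrow> complex"
    and q2 :: "'h::{finite,ab_group_add} \<Rightarrow> complex"
    and g0 :: 'g and \<gamma>0 :: 'h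
    and Gs :: "'g set" and \<Gamma>s :: "'h set"
  assumes "metric_group q1" and "metric_group q2"
    and "two_torsion = {0, g0}" and "g0 \<noteq> 0"
    and "two_torsion = {0, \<gamma>0}" and "\<gamma>0 \<noteq> 0"
    and "gauss_sum q1 1 = - gauss_sum q2 1"
    and "bichar q1 g0 g0 = - bichar q2 \<gamma>0 \<gamma>0"
    and "(gauss_sum q1 1)\<^sup>2 = inverse (q1 g0) * q2 \<gamma>0"
    and "CARD('h) = CARD('g) + 2"
    and "half_system Gs" and "half_system \<Gamma>s"
  shows "(\<forall>m::nat.
           FS_indicator q1 q2 g0 \<gamma>0 Gs \<Gamma>s m I_pi
             = complex_of_real (1/2 * (norm (gauss_sum q1 m + gauss_sum q2 m))\<^sup>2)
         \<and> (\<forall>\<epsilon>\<in>{1, -1}. FS_indicator q1 q2 g0 \<gamma>0 Gs \<Gamma>s m (I_J1 g0 \<epsilon>)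
             = complex_of_real (1/4 * (norm (gauss_sum q1 m + gauss_sum q2 m))\<^sup>2)
               + 1/2 * of_bool (nat_mult m g0 = 0) * q1 g0 ^ m)
         \<and> (\<forall>g\<in>Gs. FS_indicator q1 q2 g0 \<gamma>0 Gs \<Gamma>s m (I_G g)
             = complex_of_real (1/2 * (norm (gauss_sum q1 m + gauss_sum q2 m))\<^sup>2)
               + of_bool (nat_mult m g = 0) * q1 g ^ m)
         \<and> (\<forall>\<epsilon>\<in>{1, -1}. FS_indicator q1 q2 g0 \<gamma>0 Gs \<Gamma>s m (I_J2 \<gamma>0 \<epsilon>)
             = complex_of_real (1/4 * (norm (gauss_sum q1 m + gauss_sum q2 m))\<^sup>2)
               - 1/2 * of_bool (nat_mult m \<gamma>0 = 0) * q2 \<gamma>0 ^ m)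
         \<and> (\<forall>\<gamma>\<in>\<Gamma>s. FS_indicator q1 q2 g0 \<gamma>0 Gs \<Gamma>s m (I_Gamma \<gamma>)
             = complex_of_real (1/2 * (norm (gauss_sum q1 m + gauss_sum q2 m))\<^sup>2)
               - of_bool (nat_mult m \<gamma> = 0) * q2 \<gamma> ^ m))
       \<and> (FS2 q1 q2 g0 \<gamma>0 Gs \<Gamma>s \<longleftrightarrow> norm (gauss_sum q1 2 + gauss_sum q2 2) = sqrt 2)
       \<and> (FS3 q1 q2 g0 \<gamma>0 Gs \<Gamma>s \<longleftrightarrow> norm (gauss_sum q1 3 + gauss_sum q2 3) = 2)"
proof -
  interpret metric_group_pair q1 g0 Gs q2 \<gamma>0 \<Gamma>s "of_nat CARD('g)"
    "complex_of_real (1 / sqrt (real CARD('g)))" "complex_of_real (1 / sqrt (real CARD('h)))"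
    "s_const q1 q2 g0 \<gamma>0" "bichar q1 g0 g0" "complex_of_real (2 * sqrt 2)"
    using assms by unfold_locales (assumption | rule refl)+
  show ?thesis
    using indicators FS2_iff FS3_iff by blast
qed

end
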